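(* Let $\{X_i,i\geq 1\}$ be a sequence of negatively associated random variables with $\mathbb{E}X_i=0$ for all $i$, let $S_k=\sum_{i=1}^k X_i$, let $n\ge 1$, $0<\alpha<1$ and $p\geq 2$. Assume $$V_n:=\sum_{i=1}^{n}\mathbb{E}[|X_i|^p]<\infty,$$ and put $B_n:=\sum_{i=1}^{n}\mathbb{E}[X_i^2]$. Then, for any $x>0$, $$\mathbb{P}\Big(\max_{1\leq k\leq n}S_k>x\Big)\leq (1-\alpha)^{-1}\Big[\Big(1+\frac{2}{p}\Big)^p\frac{V_n}{\alpha^px^p}+\exp\Big\{-\alpha\frac{2}{(p+2)^2e^p}\frac{x^2}{B_n}\Big\}\Big].$$ In particular, for any $x>0$, $$\mathbb{P}\Big(\max_{1\leq k\leq n}S_k>x\Big)\leq 2^{p+1}\Big(1+\frac{2}{p}\Big)^p\frac{V_n}{x^p}+2\exp\Big\{-\frac{x^2}{(p+2)^2e^p B_n}\Big\}.$$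
   Context: A finite family $\{X_i,1\leq i\leq n\}$ of random variables is negatively associated (NA) if for every pair of disjoint subsets $A_1,A_2$ of $\{1,\dots,n\}$, $\mathrm{Cov}\{f_1(X_i,i\in A_1),f_2(X_j,j\in A_2)\}\leq 0$ whenever $f_1$ and $f_2$ are coordinatewise increasing and the covariance exists. A sequence $\{X_i,i\ge1\}$ is NA if $X_1,\dots,X_n$ is NA for every $n\ge 2$. *)

theory Defs
  imports "HOL-Probability.Probability"
begin

definition covariance :: "'a measure \<Rightarrow> ('a \<Rightarrow> real) \<Rightarrow> ('a \<Rightarrow> real) \<Rightarrow> real" where
  "covariance M Y Z =
     (\<integral>\<omega>. (Y \<omega> - (\<integral>\<eta>. Y \<eta> \<partial>M)) * (Z \<omega> - (\<integral>\<eta>. Z \<eta> \<partial>M)) \<partial>M)"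

definition covariance_exists :: "'a measure \<Rightarrow> ('a \<Rightarrow> real) \<Rightarrow> ('a \<Rightarrow> real) \<Rightarrow> bool" where
  "covariance_exists M Y Z \<longleftrightarrow>
     integrable M Y \<and> integrable M Z \<and> integrable M (\<lambda>\<omega>. Y \<omega> * Z \<omega>)"

(* A function of the coordinates in A is a function on A \<rightarrow>\<^sub>E UNIV. Functions in that set
   agree outside A, so there the pointwise order compares exactly the coordinates in A and
   mono_on says "coordinatewise nondecreasing". The test functions need not be Borel: the
   integrability in covariance_exists makes the composites random variables. *)
definition negatively_associated :: "'a measure \<Rightarrow> 'i set \<Rightarrow> ('i \<Rightarrow> 'a \<Rightarrow> real) \<Rightarrow> bool" where
  "negatively_associated M I X \<longleftrightarrow>
     finite I \<and> (\<forall>i\<in>I. X i \<in> borel_measurable M) \<and>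
     (\<forall>A B f g. A \<subseteq> I \<longrightarrow> B \<subseteq> I \<longrightarrow> A \<inter> B = {} \<longrightarrow>
        mono_on (A \<rightarrow>\<^sub>E (UNIV :: real set)) (f :: ('i \<Rightarrow> real) \<Rightarrow> real) \<longrightarrow>
        mono_on (B \<rightarrow>\<^sub>E (UNIV :: real set)) (g :: ('i \<Rightarrow> real) \<Rightarrow> real) \<longrightarrow>
        covariance_exists M (\<lambda>\<omega>. f (\<lambda>i\<in>A. X i \<omega>)) (\<lambda>\<omega>. g (\<lambda>i\<in>B. X i \<omega>)) \<longrightarrow>
        covariance M (\<lambda>\<omega>. f (\<lambda>i\<in>A. X i \<omega>)) (\<lambda>\<omega>. g (\<lambda>i\<in>B. X i \<omega>)) \<le> 0)"

(* Sequences start at index 1; the value X 0 is irrelevant. *)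
definition negatively_associated_seq :: "'a measure \<Rightarrow> (nat \<Rightarrow> 'a \<Rightarrow> real) \<Rightarrow> bool" where
  "negatively_associated_seq M X \<longleftrightarrow> (\<forall>n\<ge>2. negatively_associated M {1..n} X)"

definition partial_sum :: "(nat \<Rightarrow> 'a \<Rightarrow> real) \<Rightarrow> nat \<Rightarrow> 'a \<Rightarrow> real" where
  "partial_sum X k \<omega> = (\<Sum>i=1..k. X i \<omega>)"

definition abs_moment_sum :: "'a measure \<Rightarrow> (nat \<Rightarrow> 'a \<Rightarrow> real) \<Rightarrow> real \<Rightarrow> nat \<Rightarrow> real" where
  "abs_moment_sum M X p n = (\<Sum>i=1..n. \<integral>\<omega>. \<bar>X i \<omega>\<bar> powr p \<partial>M)"

definition second_moment_sum :: "'a measure \<Rightarrow> (nat \<Rightarrow> 'a \<Rightarrow> real) \<Rightarrow> nat \<Rightarrow> real" where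
  "second_moment_sum M X n = (\<Sum>i=1..n. \<integral>\<omega>. (X i \<omega>)\<^sup>2 \<partial>M)"

(* exp(- c x^2 / b) for c, x > 0 and b \<ge> 0, with value exp(- infinity) = 0 at b = 0, where
   real division would give x^2 / 0 = 0 and the bound would hold trivially. *)
definition gaussian_term :: "real \<Rightarrow> real \<Rightarrow> real \<Rightarrow> real" where
  "gaussian_term c x b = (if b = 0 then 0 else exp (- (c * (x\<^sup>2 / b))))"

end

theory Submission
  imports Defs
begin

text \<open>Truncate at \<open>y = \<alpha> * (p / (p + 2)) * x\<close>. The event that some \<open>X i\<close> exceeds \<open>y\<close> costs
  \<open>a = V / y powr p\<close>, where \<open>V\<close> is the sum of the absolute moments. For the truncated sums one bounds
  the \<open>\<alpha>\<close>-th moment of the running maximum \<open>Z\<close> of the products \<open>P\<close> of \<open>exp (t * min (X i) y)\<close> by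
  \<open>K powr \<alpha> / (1 - \<alpha>)\<close>, where \<open>K\<close> is the product of upper bounds \<open>b\<close> of the exponential moments.
  In the independent case this follows from Doob's inequality. Under negative association the
  summands are removed from the last one backwards: \<open>doob_bound \<alpha> Z (c * P)\<close> is concave in its last
  argument, so replacing the last factor of \<open>P\<close> by \<open>b\<close> costs only the tangent-line correction, whose
  slope is a monotone function of the preceding variables and hence negatively correlated with that
  factor. With \<open>t\<close> chosen as in the Fuk-Nagaev inequality, the exponential bound is at most the
  Gaussian term or at most \<open>\<alpha> * a / (1 - \<alpha>)\<close>, and \<open>a + \<alpha> * a / (1 - \<alpha>) = a / (1 - \<alpha>)\<close>.\<close>

section \<open>Concavity of the Doob bound\<close>

text \<open>Weighted AM-GM gives \<open>v powr \<alpha> * u powr (1 - \<alpha>) \<le> \<alpha> * v +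
  (1 - \<alpha>) * u\<close>; multiplication by \<open>u powr (\<alpha> - 1)\<close> turns this into
  the tangent line at \<open>u\<close>.\<close>

lemma powr_tangent_le:
  fixes u v \<alpha> :: real
  assumes "0 < u" "0 < v" "0 < \<alpha>" "\<alpha> < 1"
  shows "v powr \<alpha> \<le> u powr \<alpha> + \<alpha> * u powr (\<alpha> - 1) * (v - u)"
proof -
  have "(v powr \<alpha>) * (u powr (1 - \<alpha>)) \<le> \<alpha> * v + (1 - \<alpha>) * u"
    using assms by (intro Youngs_inequality_0) auto
  then have "(v powr \<alpha>) * (u powr (1 - \<alpha>)) * u powr (\<alpha> - 1)
      \<le> (u + \<alpha> * (v - u)) * u powr (\<alpha> - 1)"
    by (intro mult_right_mono) (auto simp: algebra_simps)
  moreover have "u powr (1 - \<alpha>) * u powr (\<alpha> - 1) = 1"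
    using assms by (simp flip: powr_add)
  moreover have "u * u powr (\<alpha> - 1) = u powr \<alpha>"
    using assms by (simp add: powr_mult_base)
  ultimately show ?thesis
    by (simp add: algebra_simps)
qed

text \<open>For a nonnegative supermartingale started at \<open>u\<close>, Doob's inequality bounds the expectation of
  the \<open>\<alpha>\<close>-th power of the maximum of \<open>z\<close> and its running maximum by the integral of
  \<open>min 1 (u / s)\<close> against the derivative of \<open>s powr \<alpha>\<close> over \<open>s > z\<close>, plus \<open>z powr \<alpha>\<close>. This is that
  bound.\<close>

definition doob_bound :: "real \<Rightarrow> real \<Rightarrow> real \<Rightarrow> real" where
  "doob_bound \<alpha> z u =
     (if u \<le> z then z powr \<alpha> + \<alpha> / (1 - \<alpha>) * u * z powr (\<alpha> - 1) else u powr \<alpha> / (1 - \<alpha>))"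

lemma doob_bound_diag:
  assumes "0 < z" "\<alpha> < 1"
  shows "doob_bound \<alpha> z z = z powr \<alpha> / (1 - \<alpha>)"
proof -
  have "z * z powr (\<alpha> - 1) = z powr \<alpha>"
    using assms by (simp add: powr_mult_base)
  then have "doob_bound \<alpha> z z = z powr \<alpha> + \<alpha> / (1 - \<alpha>) * z powr \<alpha>"
    by (simp add: doob_bound_def mult.assoc)
  then show ?thesis
    using assms by (simp add: field_simps)
qed

lemma doob_bound_max:
  assumes "0 < z" "0 < v" "1 \<le> c" "\<alpha> < 1"
  shows "doob_bound \<alpha> (max z v) (c * v) = doob_bound \<alpha> z (c * v)"
proof (cases "v \<le> z")
  case False
  moreover have "v \<le> c * v"
    using assms by simp
  ultimately have "v \<le> c * v" "z < c * v"
    by auto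
  then show ?thesis
    using False assms doob_bound_diag[of v \<alpha>] by (cases "c * v = v") (auto simp: doob_bound_def)
qed simp

text \<open>In its last argument \<open>doob_bound\<close> is affine up to \<open>z\<close> and a
  multiple of a concave power beyond, with equal slopes at \<open>z\<close>. It is therefore
  concave, and the coefficient of \<open>v - u\<close> is its slope at \<open>u\<close>.\<close>

lemma doob_bound_tangent_max:
  assumes "0 < z" "0 < u" "0 < v" "0 < \<alpha>" "\<alpha> < 1"
  shows "doob_bound \<alpha> z v \<le> doob_bound \<alpha> z u + \<alpha> / (1 - \<alpha>) * max u z powr (\<alpha> - 1) * (v - u)"
proof -
  define s where "s = (\<lambda>w. \<alpha> / (1 - \<alpha>) * w powr (\<alpha> - 1))"
  have lower: "doob_bound \<alpha> z w = doob_bound \<alpha> z z + s z * (w - z)" if "w \<le> z" for w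
    using that by (simp add: s_def doob_bound_def algebra_simps diff_divide_distrib)
  have upper: "doob_bound \<alpha> z w = w powr \<alpha> / (1 - \<alpha>)" if "z \<le> w" for w
    using that assms doob_bound_diag[of z \<alpha>] by (cases "w = z") (auto simp: doob_bound_def)
  have tangent: "w' powr \<alpha> / (1 - \<alpha>) \<le> w powr \<alpha> / (1 - \<alpha>) + s w * (w' - w)"
    if "0 < w" "0 < w'" for w w'
  proof -
    have "w' powr \<alpha> / (1 - \<alpha>) \<le> (w powr \<alpha> + \<alpha> * w powr (\<alpha> - 1) * (w' - w)) / (1 - \<alpha>)"
      using that assms by (intro divide_right_mono powr_tangent_le) auto
    then show ?thesis by (simp add: s_def add_divide_distrib)
  qed
  have "doob_bound \<alpha> z v \<le> doob_bound \<alpha> z u + s (max u z) * (v - u)"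
  proof -
    consider "u \<le> z" "v \<le> z" | "u \<le> z" "z \<le> v" | "z \<le> u" "z \<le> v" | "z \<le> u" "v \<le> z"
      by linarith
    then show ?thesis
    proof cases
      case 1
      then show ?thesis using lower[of u] lower[of v] by (simp add: max_def algebra_simps)
    next
      case 2
      then show ?thesis
        using lower[of u] upper[of v] upper[of z] tangent[of z v] assms
        by (simp add: max_def algebra_simps)
    next
      case 3
      then show ?thesis
        using upper[of u] upper[of v] tangent[of u v] assms by (simp add: max_def)
    next
      case 4
      \<comment> \<open>From \<open>u\<close> down to \<open>z\<close> the tangent of the power is
        used; from \<open>z\<close> down to \<open>v\<close> the slope \<open>s z\<close> is at
        least \<open>s u\<close>, while \<open>v - z\<close> is nonpositive.\<close>
      have "u powr (\<alpha> - 1) \<le> z powr (\<alpha> - 1)"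
        using 4 assms by (intro powr_mono2') auto
      then have "s z * (v - z) \<le> s u * (v - z)"
        using 4 assms by (intro mult_right_mono_neg) (auto simp: s_def intro: divide_right_mono)
      then show ?thesis
        using 4 lower[of v] upper[of u] upper[of z] tangent[of u z] assms
        by (simp add: max_def algebra_simps)
    qed
  qed
  then show ?thesis by (simp add: s_def)
qed

text \<open>The multiplicative form, \<open>v = u * r\<close>. Slope times \<open>u\<close> is
  rewritten through \<open>u\<close> and \<open>min 1 (u / z)\<close> with positive exponents. For
  \<open>u\<close> a multiple of a product and \<open>z\<close> its running maximum both are
  increasing in the factors, so the coefficient is admissible as a test function for negative
  association.\<close>

lemma doob_bound_tangent:
  assumes "0 < z" "0 < u" "0 < r" "0 < \<alpha>" "\<alpha> < 1"
  shows "doob_bound \<alpha> z (u * r)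
    \<le> doob_bound \<alpha> z u + \<alpha> / (1 - \<alpha>) * (u powr \<alpha> * min 1 (u / z) powr (1 - \<alpha>)) * (r - 1)"
proof -
  have "min 1 (u / z) = u / max u z"
    using assms by (auto simp: min_def max_def)
  then have "min 1 (u / z) powr (1 - \<alpha>) = u powr (1 - \<alpha>) * max u z powr (\<alpha> - 1)"
    using assms by (simp add: powr_divide powr_minus_divide[of _ "1 - \<alpha>", simplified])
  then have "u powr \<alpha> * min 1 (u / z) powr (1 - \<alpha>) = u * max u z powr (\<alpha> - 1)"
    using assms by (simp flip: mult.assoc powr_add)
  moreover have "u * r - u = u * (r - 1)"
    by (simp add: algebra_simps)
  ultimately show ?thesis
    using doob_bound_tangent_max[of z u "u * r" \<alpha>] assms by (simp add: mult_ac)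
qed

section \<open>Running maxima of products\<close>

text \<open>The value 1 at 0 is the empty product, so prefixes of every length from 0 to
  \<open>k\<close> compete.\<close>

primrec running_max :: "(nat \<Rightarrow> real) \<Rightarrow> nat \<Rightarrow> real" where
  "running_max a 0 = 1"
| "running_max a (Suc k) = max (running_max a k) (\<Prod>i=1..Suc k. a i)"

lemma running_max_ge_1: "1 \<le> running_max a k"
  by (induction k) auto

lemma prod_le_running_max: "j \<le> k \<Longrightarrow> (\<Prod>i=1..j. a i) \<le> running_max a k"
  by (induction k) (auto simp: le_Suc_eq max_def)

lemma running_max_cong:
  "(\<And>i. i \<in> {1..k} \<Longrightarrow> a i = a' i) \<Longrightarrow> running_max a k = running_max a' k"
  by (induction k) (auto intro!: arg_cong2[of _ _ _ _ max] prod.cong)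

lemma running_max_le:
  assumes "\<And>i. i \<in> {1..k} \<Longrightarrow> 0 \<le> a i \<and> a i \<le> C" "1 \<le> C"
  shows "running_max a k \<le> C ^ k"
  using assms(1)
proof (induction k)
  case (Suc k)
  have "(\<Prod>i=1..Suc k. a i) \<le> (\<Prod>i=1..Suc k. C)"
    using Suc.prems by (intro prod_mono) auto
  moreover have "running_max a k \<le> C ^ k" "C ^ k \<le> C ^ Suc k"
    using Suc assms(2) by (auto intro: power_increasing)
  ultimately show ?case by auto
qed simp

text \<open>The quotient is the minimum over \<open>j \<le> k\<close> of the product of the
  \<open>a i\<close> with \<open>j < i \<le> k\<close>, hence increasing although its denominator
  increases too. The induction works with the cross-multiplied inequality.\<close>

lemma prod_div_running_max_mono:
  assumes "\<And>i. i \<in> {1..k} \<Longrightarrow> 0 < a i \<and> a i \<le> a' i"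
  shows "(\<Prod>i=1..k. a i) / running_max a k \<le> (\<Prod>i=1..k. a' i) / running_max a' k"
proof -
  have "(\<Prod>i=1..k. a i) * running_max a' k \<le> (\<Prod>i=1..k. a' i) * running_max a k"
    using assms
  proof (induction k)
    case (Suc k)
    let ?P = "\<Prod>i=1..k. a i" and ?P' = "\<Prod>i=1..k. a' i"
    have IH: "?P * running_max a' k \<le> ?P' * running_max a k"
      using Suc by auto
    have a: "0 < a (Suc k)" "a (Suc k) \<le> a' (Suc k)"
      using Suc.prems by auto
    have "0 < a i \<and> a i \<le> a' i" if "i \<in> {1..k}" for i
      using Suc.prems[of i] that by auto
    then have P: "0 \<le> ?P" and P': "0 \<le> ?P'"
      by (intro prod_nonneg; meson less_imp_le order.trans)+
    have "(?P * running_max a' k) * a (Suc k) \<le> (?P' * running_max a k) * a' (Suc k)"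
      using a P' running_max_ge_1[of a k] by (intro mult_mono[OF IH]) auto
    also have "\<dots> \<le> ?P' * a' (Suc k) * max (running_max a k) (?P * a (Suc k))"
    proof -
      have "?P' * a' (Suc k) * running_max a k
          \<le> ?P' * a' (Suc k) * max (running_max a k) (?P * a (Suc k))"
        using P' a by (intro mult_left_mono) auto
      then show ?thesis by (simp add: mult_ac)
    qed
    finally have 1: "?P * a (Suc k) * running_max a' k
        \<le> ?P' * a' (Suc k) * max (running_max a k) (?P * a (Suc k))"
      by (simp add: mult_ac)
    have 2: "?P * a (Suc k) * (?P' * a' (Suc k))
        \<le> ?P' * a' (Suc k) * max (running_max a k) (?P * a (Suc k))"
      using P' a by (subst mult.commute) (intro mult_left_mono, auto)
    \<comment> \<open>\<open>2\<close> serves the case in which the newest product becomes the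
      running maximum of \<open>a'\<close>, \<open>1\<close> the case in which the old maximum
      survives.\<close>
    show ?case
      using 1 2 by (cases "running_max a' k \<le> ?P' * a' (Suc k)") (auto simp: max_def mult_ac)
  qed simp
  then show ?thesis
    using running_max_ge_1[of a k] running_max_ge_1[of a' k] by (simp add: field_simps)
qed

section \<open>Exponential moments of truncated variables\<close>

text \<open>Second-order Taylor formula with intermediate point \<open>s\<close> between 0 and
  \<open>u\<close>. As \<open>q\<close> is nonnegative, \<open>s \<le> q\<close> also for negative
  \<open>u\<close>.\<close>

lemma exp_le_quadratic:
  fixes u q :: real
  assumes "u \<le> q" "0 \<le> q"
  shows "exp u - 1 - u \<le> exp q * u\<^sup>2 / 2"
proof (cases "u = 0")
  case False
  obtain s where s: "\<bar>s\<bar> \<le> \<bar>u\<bar>" "s \<le> max u 0"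
    "exp u = 1 + u + exp s / 2 * u\<^sup>2"
  proof (cases "0 < u")
    case True
    obtain s where "0 < s" "s < u" "exp u = (\<Sum>m<2. exp 0 / fact m * u ^ m) + exp s / fact 2 * u ^ 2"
      using Maclaurin[of u 2 "\<lambda>_. exp" exp] True by auto
    then show ?thesis by (intro that[of s]) (auto simp: numeral_2_eq_2)
  next
    case F: False
    then have "u < 0" using False by auto
    then obtain s where "u < s" "s < 0" "exp u = (\<Sum>m<2. exp 0 / fact m * u ^ m) + exp s / fact 2 * u ^ 2"
      using Maclaurin_minus[of u 2 "\<lambda>_. exp" exp] by auto
    then show ?thesis by (intro that[of s]) (auto simp: numeral_2_eq_2)
  qed
  have "exp s / 2 * u\<^sup>2 \<le> exp q / 2 * u\<^sup>2"
    using s assms by (intro mult_right_mono) auto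
  then show ?thesis using s by simp
qed simp

lemma exp_remainder_nonneg: "0 \<le> exp u - 1 - (u::real)"
  using exp_ge_add_one_self[of u] by linarith

text \<open>Up to a positive factor the derivative is \<open>(s - p) * (exp s - 1) + p * s\<close>,
  which is nonnegative from \<open>p\<close> on.\<close>

lemma exp_remainder_div_powr_mono:
  fixes p u w :: real
  assumes "0 < p" "p \<le> u" "u \<le> w"
  shows "(exp u - 1 - u) / u powr p \<le> (exp w - 1 - w) / w powr p"
proof (rule DERIV_nonneg_imp_nondecreasing[OF assms(3)])
  fix s assume s: "u \<le> s" "s \<le> w"
  then have "0 < s" using assms by linarith
  let ?d = "((exp s - 1) * s powr p - (exp s - 1 - s) * (p * s powr (p - 1))) / (s powr p * s powr p)"
  have "((\<lambda>s. (exp s - 1 - s) / s powr p) has_real_derivative ?d) (at s)"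
    using \<open>0 < s\<close> by (auto intro!: derivative_eq_intros)
  moreover have "0 \<le> ?d"
  proof -
    have "s powr p = s powr (p - 1) * s"
      using \<open>0 < s\<close> by (simp add: powr_mult_base mult.commute)
    then have "(exp s - 1) * s powr p - (exp s - 1 - s) * (p * s powr (p - 1))
      = s powr (p - 1) * ((s - p) * (exp s - 1) + p * s)"
      by (simp add: algebra_simps)
    also have "\<dots> \<ge> 0"
      using s assms \<open>0 < s\<close> by (intro mult_nonneg_nonneg add_nonneg_nonneg) auto
    finally show ?thesis by simp
  qed
  ultimately show "\<exists>d. ((\<lambda>s. (exp s - 1 - s) / s powr p) has_real_derivative d) (at s) \<and> 0 \<le> d"
    by blast
qed

text \<open>Up to \<open>p\<close> the quadratic bound suffices alone. Setting the remainder to 0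
  there removes the \<open>p\<close>-th moment term entirely whenever
  \<open>t * y \<le> p\<close>.\<close>

definition exp_remainder_beyond :: "real \<Rightarrow> real \<Rightarrow> real" where
  "exp_remainder_beyond p u = (if p < u then exp u - 1 - u else 0)"

text \<open>If the exponent is at most \<open>p\<close>, the quadratic bound with
  \<open>q = p\<close> applies. Otherwise \<open>min x y\<close> is positive and the remainder
  divided by the \<open>p\<close>-th power grows up to the endpoint \<open>t * y\<close>. The linear
  term stays the untruncated \<open>t * x\<close>, which vanishes in the mean for centred
  \<open>x\<close>.\<close>

lemma exp_truncated_le:
  fixes x y t p :: real
  assumes "0 < y" "0 < t" "0 < p"
  shows "exp (t * min x y)
    \<le> 1 + t * x + (exp p * t\<^sup>2 / 2 * x\<^sup>2 + exp_remainder_beyond p (t * y) / y powr p * \<bar>x\<bar> powr p)"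
proof -
  let ?u = "t * min x y"
  have abs_min: "\<bar>min x y\<bar> \<le> \<bar>x\<bar>"
    using assms by (auto simp: min_def)
  have u: "?u \<le> t * x" "?u \<le> t * y"
    using assms by auto
  have nonneg: "0 \<le> exp_remainder_beyond p (t * y)"
    using exp_remainder_nonneg[of "t * y"] by (auto simp: exp_remainder_beyond_def)
  show ?thesis
  proof (cases "?u \<le> p")
    case True
    have "exp ?u - 1 - ?u \<le> exp p * ?u\<^sup>2 / 2"
      using True assms by (intro exp_le_quadratic) auto
    also have "?u\<^sup>2 \<le> t\<^sup>2 * x\<^sup>2"
      using abs_min by (auto simp: power_mult_distrib abs_le_square_iff intro!: mult_left_mono)
    finally have "exp ?u - 1 - ?u \<le> exp p * t\<^sup>2 / 2 * x\<^sup>2"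
      by (simp add: mult_ac)
    moreover have "0 \<le> exp_remainder_beyond p (t * y) / y powr p * \<bar>x\<bar> powr p"
      using nonneg by simp
    ultimately show ?thesis
      using u by linarith
  next
    case False
    then have pos: "0 < ?u" "0 < min x y"
      using assms by (auto simp: not_le zero_less_mult_iff dest: order.strict_trans)
    have "(exp ?u - 1 - ?u) / ?u powr p \<le> (exp (t * y) - 1 - t * y) / (t * y) powr p"
      using False assms u by (intro exp_remainder_div_powr_mono) auto
    moreover have "p < t * y"
      using False u by linarith
    ultimately have "(exp ?u - 1 - ?u) / ?u powr p \<le> exp_remainder_beyond p (t * y) / (t powr p * y powr p)"
      using assms by (simp add: exp_remainder_beyond_def powr_mult)
    then have "exp ?u - 1 - ?u \<le> exp_remainder_beyond p (t * y) / (t powr p * y powr p) * ?u powr p"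
      using pos(1) by (subst (asm) pos_divide_le_eq) (auto simp only: powr_gt_zero)
    also have "\<dots> = exp_remainder_beyond p (t * y) / y powr p * \<bar>min x y\<bar> powr p"
      using pos assms by (simp add: powr_mult)
    also have "\<dots> \<le> exp_remainder_beyond p (t * y) / y powr p * \<bar>x\<bar> powr p"
      using nonneg assms abs_min by (intro mult_left_mono powr_mono2) auto
    finally have "exp ?u - 1 - ?u \<le> exp_remainder_beyond p (t * y) / y powr p * \<bar>x\<bar> powr p" .
    moreover have "0 \<le> exp p * t\<^sup>2 / 2 * x\<^sup>2"
      by simp
    ultimately show ?thesis
      using u by linarith
  qed
qed

section \<open>A maximal inequality under negative association\<close>

lemma doob_bound_le:
  assumes "0 < z" "0 < u" "0 < \<alpha>" "\<alpha> < 1"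
  shows "doob_bound \<alpha> z u \<le> max z u powr \<alpha> / (1 - \<alpha>)"
proof (cases "u \<le> z")
  case True
  then have "\<alpha> / (1 - \<alpha>) * u * z powr (\<alpha> - 1) \<le> \<alpha> / (1 - \<alpha>) * z * z powr (\<alpha> - 1)"
    using assms by (intro mult_right_mono mult_left_mono) auto
  then have "doob_bound \<alpha> z u \<le> doob_bound \<alpha> z z"
    using True by (simp add: doob_bound_def)
  then show ?thesis
    using True assms by (simp add: doob_bound_diag max_def)
qed (auto simp: doob_bound_def)

lemma doob_bound_nonneg:
  assumes "0 < z" "0 < u" "0 < \<alpha>" "\<alpha> < 1"
  shows "0 \<le> doob_bound \<alpha> z u"
  using assms by (auto simp: doob_bound_def)

lemma measurable_doob_bound [measurable]:
  assumes [measurable]: "f \<in> borel_measurable M" "g \<in> borel_measurable M"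
  shows "(\<lambda>\<omega>. doob_bound \<alpha> (f \<omega>) (g \<omega>)) \<in> borel_measurable M"
  unfolding doob_bound_def by measurable

lemma measurable_running_max:
  "(\<And>i. i \<in> {1..k} \<Longrightarrow> a i \<in> borel_measurable M) \<Longrightarrow>
    (\<lambda>\<omega>. running_max (\<lambda>i. a i \<omega>) k) \<in> borel_measurable M"
  by (induction k) (auto intro!: borel_measurable_max borel_measurable_prod simp del: prod.cl_ivl_Suc)

lemma negatively_associated_integral_mult_le:
  fixes f g :: "('i \<Rightarrow> real) \<Rightarrow> real"
  assumes "prob_space M" and NA: "negatively_associated M I X"
    and "A \<subseteq> I" "B \<subseteq> I" "A \<inter> B = {}"
    and "mono_on (A \<rightarrow>\<^sub>E (UNIV :: real set)) f" "mono_on (B \<rightarrow>\<^sub>E (UNIV :: real set)) g"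
    and int: "integrable M (\<lambda>\<omega>. f (\<lambda>i\<in>A. X i \<omega>))" "integrable M (\<lambda>\<omega>. g (\<lambda>i\<in>B. X i \<omega>))"
      "integrable M (\<lambda>\<omega>. f (\<lambda>i\<in>A. X i \<omega>) * g (\<lambda>i\<in>B. X i \<omega>))"
  shows "(\<integral>\<omega>. f (\<lambda>i\<in>A. X i \<omega>) * g (\<lambda>i\<in>B. X i \<omega>) \<partial>M)
    \<le> (\<integral>\<omega>. f (\<lambda>i\<in>A. X i \<omega>) \<partial>M) * (\<integral>\<omega>. g (\<lambda>i\<in>B. X i \<omega>) \<partial>M)"
proof -
  interpret prob_space M by fact
  let ?f = "\<lambda>\<omega>. f (\<lambda>i\<in>A. X i \<omega>)" and ?g = "\<lambda>\<omega>. g (\<lambda>i\<in>B. X i \<omega>)"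
  have "covariance M ?f ?g \<le> 0"
    using NA assms(3-7) int unfolding negatively_associated_def covariance_exists_def by blast
  moreover have "covariance M ?f ?g
    = (\<integral>\<omega>. ?f \<omega> * ?g \<omega> - expectation ?g * ?f \<omega> - expectation ?f * ?g \<omega>
        + expectation ?f * expectation ?g \<partial>M)"
    unfolding covariance_def by (intro Bochner_Integration.integral_cong) (auto simp: algebra_simps)
  moreover have "\<dots> = expectation (\<lambda>\<omega>. ?f \<omega> * ?g \<omega>) - expectation ?f * expectation ?g"
    using int by (simp add: prob_space)
  ultimately show ?thesis by simp
qed

text \<open>One backward step: the last factor is exchanged for its bound \<open>b\<close>, while
  \<open>c\<close> collects the bounds of the factors removed before. The tangent inequality is used
  with \<open>r = \<phi> (X (Suc j) \<omega>) / b\<close>; its correction has nonpositive mean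
  because the coefficient increases in the first \<open>j\<close> variables.\<close>

lemma doob_bound_step:
  fixes X :: "nat \<Rightarrow> 'a \<Rightarrow> real" and \<phi> :: "real \<Rightarrow> real"
  assumes "prob_space M" and NA: "negatively_associated M I X" and I: "{1..Suc j} \<subseteq> I"
    and \<phi>: "mono \<phi>" "\<And>s. 0 < \<phi> s" "\<And>s. \<phi> s \<le> C"
    and b: "1 \<le> b" "(\<integral>\<omega>. \<phi> (X (Suc j) \<omega>) \<partial>M) \<le> b"
    and c: "1 \<le> c" and \<alpha>: "0 < \<alpha>" "\<alpha> < 1"
  shows "(\<integral>\<omega>. doob_bound \<alpha> (running_max (\<lambda>i. \<phi> (X i \<omega>)) (Suc j))
            (c * (\<Prod>i=1..Suc j. \<phi> (X i \<omega>))) \<partial>M)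
    \<le> (\<integral>\<omega>. doob_bound \<alpha> (running_max (\<lambda>i. \<phi> (X i \<omega>)) j)
            (b * c * (\<Prod>i=1..j. \<phi> (X i \<omega>))) \<partial>M)"
proof -
  interpret prob_space M by fact
  define C' where "C' = max 1 C"
  have C': "1 \<le> C'" "\<And>s. \<phi> s \<le> C'"
    using \<phi>(3) by (auto simp: C'_def le_max_iff_disj)
  have [measurable]: "\<phi> \<in> borel_measurable borel"
    by (rule borel_measurable_mono) fact
  have X_meas: "X i \<in> borel_measurable M" if "i \<in> {1..Suc j}" for i
    using NA I that by (auto simp: negatively_associated_def)
  have a_meas: "(\<lambda>\<omega>. \<phi> (X i \<omega>)) \<in> borel_measurable M" if "i \<in> {1..Suc j}" for i
    using X_meas[OF that] by measurable
  let ?Z = "\<lambda>k (x :: nat \<Rightarrow> real). running_max (\<lambda>i. \<phi> (x i)) k"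
  let ?P = "\<lambda>k (x :: nat \<Rightarrow> real). \<Prod>i=1..k. \<phi> (x i)"
  let ?x = "\<lambda>\<omega> i. X i \<omega>"
  define u where "u x = b * c * ?P j x" for x :: "nat \<Rightarrow> real"
  \<comment> \<open>Up to the constant \<open>\<alpha> / (1 - \<alpha>)\<close> this is the
    coefficient of \<open>r - 1\<close> in \<open>doob_bound_tangent\<close>.\<close>
  define w where "w x = u x powr \<alpha> * min 1 (u x / ?Z j x) powr (1 - \<alpha>)" for x :: "nat \<Rightarrow> real"
  have P_pos: "0 < ?P k x" for k x
    using \<phi>(2) by (intro prod_pos) auto
  have P_le: "?P k x \<le> C' ^ k" for k x
  proof -
    have "?P k x \<le> (\<Prod>i=1..k. C')"
      using C' \<phi>(2) by (intro prod_mono) (auto simp: less_imp_le)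
    then show ?thesis by simp
  qed
  have Z: "1 \<le> ?Z k x" "?Z k x \<le> C' ^ k" for k x
    using C' \<phi>(2) by (auto intro!: running_max_ge_1 running_max_le simp: less_imp_le)
  have Z_pos: "0 < ?Z k x" for k x
    using Z(1)[of x k] by linarith
  have u_pos: "0 < u x" for x
    using P_pos[of x j] b c unfolding u_def by (intro mult_pos_pos) auto
  have u_le: "u x \<le> b * c * C' ^ j" for x
    using P_le[of x j] b c unfolding u_def by (intro mult_left_mono) auto
  have w_nonneg: "0 \<le> w x" for x
    by (simp add: w_def)
  have w_le: "w x \<le> (b * c * C' ^ j) powr \<alpha>" for x
  proof -
    have "min 1 (u x / ?Z j x) powr (1 - \<alpha>) \<le> 1 powr (1 - \<alpha>)"
      using u_pos[of x] Z_pos[of x j] \<alpha> by (intro powr_mono2) auto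
    then have "w x \<le> u x powr \<alpha> * 1"
      unfolding w_def by (intro mult_left_mono) auto
    also have "\<dots> \<le> (b * c * C' ^ j) powr \<alpha>"
      using u_pos[of x] u_le[of x] \<alpha> by (auto intro: powr_mono2)
    finally show ?thesis .
  qed
  have [measurable]: "(\<lambda>\<omega>. ?P k (?x \<omega>)) \<in> borel_measurable M"
      "(\<lambda>\<omega>. ?Z k (?x \<omega>)) \<in> borel_measurable M" if "k \<le> Suc j" for k
    using that by (auto intro!: borel_measurable_prod measurable_running_max a_meas)
  have [measurable]: "(\<lambda>\<omega>. u (?x \<omega>)) \<in> borel_measurable M" "(\<lambda>\<omega>. w (?x \<omega>)) \<in> borel_measurable M"
    unfolding u_def w_def by measurable
  have [measurable]: "(\<lambda>\<omega>. \<phi> (X (Suc j) \<omega>)) \<in> borel_measurable M"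
    by (rule a_meas) simp
  have int_doob: "integrable M (\<lambda>\<omega>. doob_bound \<alpha> (?Z k (?x \<omega>)) (d * ?P k (?x \<omega>)))"
    if "1 \<le> d" "k \<le> Suc j" for k d
  proof (rule integrable_const_bound)
    show "AE \<omega> in M. norm (doob_bound \<alpha> (?Z k (?x \<omega>)) (d * ?P k (?x \<omega>)))
        \<le> (d * C' ^ k) powr \<alpha> / (1 - \<alpha>)"
    proof (rule AE_I2)
      fix \<omega>
      let ?z = "?Z k (?x \<omega>)" and ?v = "d * ?P k (?x \<omega>)"
      have "0 < ?v" 
        using that P_pos by simp
      moreover have "?v \<le> d * C' ^ k"
        using that P_le by (intro mult_left_mono) auto
      moreover have "1 * ?z \<le> d * C' ^ k"
        using that Z(2) Z_pos[THEN less_imp_le] by (intro mult_mono) auto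
      ultimately have "max ?z ?v powr \<alpha> / (1 - \<alpha>) \<le> (d * C' ^ k) powr \<alpha> / (1 - \<alpha>)"
        using \<alpha> Z_pos[of "?x \<omega>" k] by (intro divide_right_mono powr_mono2) auto
      then show "norm (doob_bound \<alpha> ?z ?v) \<le> (d * C' ^ k) powr \<alpha> / (1 - \<alpha>)"
        using doob_bound_le[OF Z_pos \<open>0 < ?v\<close> \<alpha>, of "?x \<omega>" k]
          doob_bound_nonneg[OF Z_pos \<open>0 < ?v\<close> \<alpha>, of "?x \<omega>" k] by simp
    qed
  qed (use that in measurable)
  have int_w: "integrable M (\<lambda>\<omega>. w (?x \<omega>))"
    using w_nonneg w_le by (intro integrable_const_bound[where B = "(b * c * C' ^ j) powr \<alpha>"]) auto
  have int_a: "integrable M (\<lambda>\<omega>. \<phi> (X (Suc j) \<omega>))"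
    using \<phi>(2) C' by (intro integrable_const_bound[where B = C']) (auto simp: less_imp_le)
  have int_wa: "integrable M (\<lambda>\<omega>. w (?x \<omega>) * \<phi> (X (Suc j) \<omega>))"
    using w_nonneg w_le \<phi>(2) C'
    by (intro integrable_const_bound[where B = "(b * c * C' ^ j) powr \<alpha> * C'"])
      (auto simp: less_imp_le abs_mult intro!: mult_mono)
  \<comment> \<open>The test functions of negative association see vectors restricted to their index
    set; \<open>w\<close> reads only the coordinates 1 to \<open>j\<close>.\<close>
  have w_restrict: "w (\<lambda>i\<in>{1..j}. X i \<omega>) = w (?x \<omega>)" for \<omega>
  proof -
    have "?Z j (\<lambda>i\<in>{1..j}. X i \<omega>) = ?Z j (?x \<omega>)"
      by (rule running_max_cong) auto
    moreover have "?P j (\<lambda>i\<in>{1..j}. X i \<omega>) = ?P j (?x \<omega>)"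
      by (rule prod.cong) auto
    ultimately show ?thesis
      unfolding w_def u_def by simp
  qed
  have "mono_on ({1..j} \<rightarrow>\<^sub>E UNIV) w"
  proof (rule mono_onI)
    fix x x' :: "nat \<Rightarrow> real" assume "x \<le> x'"
    then have le: "\<phi> (x i) \<le> \<phi> (x' i)" for i
      using \<phi>(1) by (auto simp: le_fun_def mono_def)
    have "?P j x \<le> ?P j x'"
      using le \<phi>(2) by (intro prod_mono) (auto simp: less_imp_le)
    then have "u x \<le> u x'"
      using b c unfolding u_def by (intro mult_left_mono) auto
    moreover have "?P j x / ?Z j x \<le> ?P j x' / ?Z j x'"
      using le \<phi>(2) by (intro prod_div_running_max_mono) auto
    then have "b * c * (?P j x / ?Z j x) \<le> b * c * (?P j x' / ?Z j x')"
      using b c by (intro mult_left_mono) auto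
    then have "u x / ?Z j x \<le> u x' / ?Z j x'"
      by (simp add: u_def)
    ultimately show "w x \<le> w x'"
      unfolding w_def using u_pos Z_pos \<alpha>
      by (intro mult_mono powr_mono2 min.mono) (auto simp: less_imp_le)
  qed
  moreover have "mono_on ({Suc j} \<rightarrow>\<^sub>E UNIV) (\<lambda>x. \<phi> (x (Suc j)))"
    using \<phi>(1) by (auto intro!: mono_onI simp: le_fun_def mono_def)
  moreover have "{1..j} \<subseteq> I" "{Suc j} \<subseteq> I" "{1..j} \<inter> {Suc j} = {}"
    using I by auto
  ultimately have "expectation (\<lambda>\<omega>. w (?x \<omega>) * \<phi> (X (Suc j) \<omega>))
      \<le> expectation (\<lambda>\<omega>. w (?x \<omega>)) * expectation (\<lambda>\<omega>. \<phi> (X (Suc j) \<omega>))"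
    using negatively_associated_integral_mult_le[OF \<open>prob_space M\<close> NA, of "{1..j}" "{Suc j}" w
        "\<lambda>x. \<phi> (x (Suc j))", unfolded w_restrict] int_w int_a int_wa
    by simp
  also have "\<dots> \<le> expectation (\<lambda>\<omega>. w (?x \<omega>)) * b"
    using b w_nonneg by (intro mult_left_mono integral_nonneg_AE) auto
  \<comment> \<open>Negative association and the bound \<open>b\<close> on the mean of the last
    factor together make the averaged correction nonpositive.\<close>
  finally have corr: "expectation (\<lambda>\<omega>. w (?x \<omega>) * \<phi> (X (Suc j) \<omega>)) / b - expectation (\<lambda>\<omega>. w (?x \<omega>)) \<le> 0"
    using b by (simp add: divide_le_eq)
  have pointwise: "doob_bound \<alpha> (?Z (Suc j) x) (c * ?P (Suc j) x)
      \<le> doob_bound \<alpha> (?Z j x) (u x) + \<alpha> / (1 - \<alpha>) * (w x * \<phi> (x (Suc j)) / b - w x)" for x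
  proof -
    have "c * ?P (Suc j) x = u x * (\<phi> (x (Suc j)) / b)"
      using b by (simp add: u_def)
    then have "doob_bound \<alpha> (?Z (Suc j) x) (c * ?P (Suc j) x)
        = doob_bound \<alpha> (?Z j x) (u x * (\<phi> (x (Suc j)) / b))"
      using doob_bound_max[OF Z_pos P_pos c \<alpha>(2), of x j x "Suc j"]
      by (simp del: prod.cl_ivl_Suc)
    also have "\<dots> \<le> doob_bound \<alpha> (?Z j x) (u x) + \<alpha> / (1 - \<alpha>) * w x * (\<phi> (x (Suc j)) / b - 1)"
      unfolding w_def using b \<phi>(2) u_pos Z_pos \<alpha> by (intro doob_bound_tangent) auto
    also have "\<alpha> / (1 - \<alpha>) * w x * (\<phi> (x (Suc j)) / b - 1)
        = \<alpha> / (1 - \<alpha>) * (w x * \<phi> (x (Suc j)) / b - w x)"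
      by (simp only: mult.assoc right_diff_distrib mult_1_right times_divide_eq_right)
    finally show ?thesis .
  qed
  have "1 * 1 \<le> b * c"
    using b c by (intro mult_mono) auto
  then have int_u: "integrable M (\<lambda>\<omega>. doob_bound \<alpha> (?Z j (?x \<omega>)) (u (?x \<omega>)))"
    unfolding u_def by (intro int_doob) auto
  have int_corr: "integrable M (\<lambda>\<omega>. \<alpha> / (1 - \<alpha>) * (w (?x \<omega>) * \<phi> (X (Suc j) \<omega>) / b - w (?x \<omega>)))"
    using int_w int_wa
    by (intro integrable_mult_right Bochner_Integration.integrable_diff integrable_divide_zero)
  have "expectation (\<lambda>\<omega>. doob_bound \<alpha> (?Z (Suc j) (?x \<omega>)) (c * ?P (Suc j) (?x \<omega>)))
      \<le> expectation (\<lambda>\<omega>. doob_bound \<alpha> (?Z j (?x \<omega>)) (u (?x \<omega>))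
          + \<alpha> / (1 - \<alpha>) * (w (?x \<omega>) * \<phi> (X (Suc j) \<omega>) / b - w (?x \<omega>)))"
    by (intro integral_mono int_doob[OF c order.refl] pointwise
        Bochner_Integration.integrable_add int_u int_corr)
  also have "\<dots> = expectation (\<lambda>\<omega>. doob_bound \<alpha> (?Z j (?x \<omega>)) (u (?x \<omega>)))
      + expectation (\<lambda>\<omega>. \<alpha> / (1 - \<alpha>) * (w (?x \<omega>) * \<phi> (X (Suc j) \<omega>) / b - w (?x \<omega>)))"
    by (intro Bochner_Integration.integral_add int_u int_corr)
  also have "expectation (\<lambda>\<omega>. \<alpha> / (1 - \<alpha>) * (w (?x \<omega>) * \<phi> (X (Suc j) \<omega>) / b - w (?x \<omega>)))
      = \<alpha> / (1 - \<alpha>) * (expectation (\<lambda>\<omega>. w (?x \<omega>) * \<phi> (X (Suc j) \<omega>)) / b - expectation (\<lambda>\<omega>. w (?x \<omega>)))"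
    using int_w int_wa by simp
  finally have "expectation (\<lambda>\<omega>. doob_bound \<alpha> (?Z (Suc j) (?x \<omega>)) (c * ?P (Suc j) (?x \<omega>)))
      \<le> expectation (\<lambda>\<omega>. doob_bound \<alpha> (?Z j (?x \<omega>)) (u (?x \<omega>)))"
    using mult_nonneg_nonpos[OF divide_nonneg_nonneg corr, of \<alpha> "1 - \<alpha>"] \<alpha> by linarith
  then show ?thesis
    by (simp only: u_def)
qed

text \<open>Markov's inequality for the \<open>\<alpha>\<close>-th power. The mean of
  \<open>?D k\<close> can only grow as \<open>k\<close> decreases, from a majorant of that power at
  \<open>k = n\<close> to a deterministic value at \<open>k = 0\<close>.\<close>

lemma negatively_associated_running_max_tail:
  fixes X :: "nat \<Rightarrow> 'a \<Rightarrow> real" and \<phi> :: "real \<Rightarrow> real" and b :: "nat \<Rightarrow> real"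
  assumes "prob_space M" and NA: "negatively_associated M I X" and I: "{1..n} \<subseteq> I"
    and \<phi>: "mono \<phi>" "\<And>s. 0 < \<phi> s" "\<And>s. \<phi> s \<le> C"
    and b: "\<And>i. i \<in> {1..n} \<Longrightarrow> 1 \<le> b i"
      "\<And>i. i \<in> {1..n} \<Longrightarrow> (\<integral>\<omega>. \<phi> (X i \<omega>) \<partial>M) \<le> b i"
    and \<alpha>: "0 < \<alpha>" "\<alpha> < 1" and v: "0 < v"
  shows "measure M {\<omega> \<in> space M. v \<le> running_max (\<lambda>i. \<phi> (X i \<omega>)) n}
    \<le> ((\<Prod>i=1..n. b i) / v) powr \<alpha> / (1 - \<alpha>)"
proof -
  interpret prob_space M by fact
  let ?Z = "\<lambda>k \<omega>. running_max (\<lambda>i. \<phi> (X i \<omega>)) k"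
  let ?P = "\<lambda>k \<omega>. \<Prod>i=1..k. \<phi> (X i \<omega>)"
  let ?D = "\<lambda>k \<omega>. doob_bound \<alpha> (?Z k \<omega>) ((\<Prod>i=Suc k..n. b i) * ?P k \<omega>)"
  define C' where "C' = max 1 C"
  have C': "1 \<le> C'" "\<And>s. \<phi> s \<le> C'"
    using \<phi>(3) by (auto simp: C'_def le_max_iff_disj)
  have [measurable]: "\<phi> \<in> borel_measurable borel"
    by (rule borel_measurable_mono) fact
  have [measurable]: "(\<lambda>\<omega>. \<phi> (X i \<omega>)) \<in> borel_measurable M" if "i \<in> {1..n}" for i
  proof -
    have [measurable]: "X i \<in> borel_measurable M"
      using NA I that by (auto simp: negatively_associated_def)
    show ?thesis by measurable
  qed
  have [measurable]: "?Z n \<in> borel_measurable M" "?P n \<in> borel_measurable M"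
    by (auto intro!: borel_measurable_prod measurable_running_max)
  have P_pos: "0 < ?P k \<omega>" for k \<omega>
    using \<phi>(2) by (intro prod_pos) auto
  have Z: "1 \<le> ?Z k \<omega>" "?Z k \<omega> \<le> C' ^ k" for k \<omega>
    using C' \<phi>(2) by (auto intro!: running_max_ge_1 running_max_le simp: less_imp_le)
  have Z_pos: "0 < ?Z k \<omega>" for k \<omega>
    using Z(1)[of \<omega> k] by linarith
  have P_le_Z: "?P k \<omega> \<le> ?Z k \<omega>" for k \<omega>
    by (rule prod_le_running_max) simp
  have chain: "expectation (?D k) \<le> (\<Prod>i=1..n. b i) powr \<alpha> / (1 - \<alpha>)" if "k \<le> n" for k
    using that
  proof (induction k)
    case 0
    \<comment> \<open>At \<open>k = 0\<close> the running maximum and the product are both 1; since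
      all \<open>b i\<close> are at least 1, the maximum in \<open>doob_bound_le\<close> is their
      product.\<close>
    have "1 \<le> (\<Prod>i=1..n. b i)"
      using b by (intro prod_ge_1) auto
    then show ?case
      using doob_bound_le[of 1 "\<Prod>i=1..n. b i" \<alpha>] \<alpha> by (simp add: prob_space max_def)
  next
    case (Suc k)
    have "(\<Prod>i=Suc k..n. b i) = b (Suc k) * (\<Prod>i=Suc (Suc k)..n. b i)"
      using Suc.prems by (intro prod.atLeast_Suc_atMost) auto
    moreover have "1 \<le> (\<Prod>i=Suc (Suc k)..n. b i)"
      using b by (intro prod_ge_1) auto
    ultimately have "expectation (?D (Suc k)) \<le> expectation (?D k)"
      using doob_bound_step[OF \<open>prob_space M\<close> NA _ \<phi> b(1)[of "Suc k"] b(2)[of "Suc k"], of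
          "\<Prod>i=Suc (Suc k)..n. b i" \<alpha>] I Suc.prems \<alpha> by fastforce
    then show ?case
      using Suc by simp
  qed
  \<comment> \<open>At \<open>k = n\<close> the product of bounds is empty, so the last argument is
    at most the running maximum and the affine branch applies.\<close>
  have "(?Z n \<omega>) powr \<alpha> \<le> ?D n \<omega>" for \<omega>
    using P_pos[of \<omega> n] P_le_Z[of \<omega> n] \<alpha> by (simp add: doob_bound_def less_imp_le)
  moreover have "integrable M (?D n)"
  proof (rule integrable_const_bound)
    show "AE \<omega> in M. norm (?D n \<omega>) \<le> (C' ^ n) powr \<alpha> / (1 - \<alpha>)"
    proof (rule AE_I2)
      fix \<omega>
      have "?Z n \<omega> powr \<alpha> / (1 - \<alpha>) \<le> (C' ^ n) powr \<alpha> / (1 - \<alpha>)"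
        using Z Z_pos[of \<omega> n] \<alpha> by (intro divide_right_mono powr_mono2) auto
      then show "norm (?D n \<omega>) \<le> (C' ^ n) powr \<alpha> / (1 - \<alpha>)"
        using doob_bound_le[OF Z_pos P_pos \<alpha>, of \<omega> n \<omega> n]
          doob_bound_nonneg[OF Z_pos P_pos \<alpha>, of \<omega> n \<omega> n] P_le_Z[of \<omega> n] by (simp add: max_def)
    qed
  qed measurable
  moreover have int: "integrable M (\<lambda>\<omega>. ?Z n \<omega> powr \<alpha>)"
    using Z Z_pos \<alpha> by (intro integrable_const_bound[where B = "(C' ^ n) powr \<alpha>"])
      (auto intro!: powr_mono2 simp: less_imp_le)
  ultimately have "expectation (\<lambda>\<omega>. ?Z n \<omega> powr \<alpha>) \<le> (\<Prod>i=1..n. b i) powr \<alpha> / (1 - \<alpha>)"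
    using chain[of n] integral_mono[of M "\<lambda>\<omega>. ?Z n \<omega> powr \<alpha>" "?D n"] by force
  moreover have "{\<omega> \<in> space M. v \<le> ?Z n \<omega>} = {\<omega> \<in> space M. v powr \<alpha> \<le> ?Z n \<omega> powr \<alpha>}"
  proof -
    have "v \<le> z \<longleftrightarrow> v powr \<alpha> \<le> z powr \<alpha>" if "0 < z" for z
      using that v \<alpha> powr_mono2[of \<alpha> v z] powr_less_mono2[of \<alpha> z v] by (cases "v \<le> z") auto
    then show ?thesis
      using Z_pos by simp
  qed
  ultimately have "measure M {\<omega> \<in> space M. v \<le> ?Z n \<omega>}
      \<le> (\<Prod>i=1..n. b i) powr \<alpha> / (1 - \<alpha>) / v powr \<alpha>"
    using integral_Markov_inequality_measure[OF int, of "{}" "v powr \<alpha>"] v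
      divide_right_mono[of "expectation (\<lambda>\<omega>. ?Z n \<omega> powr \<alpha>)" "(\<Prod>i=1..n. b i) powr \<alpha> / (1 - \<alpha>)"
        "v powr \<alpha>"]
    by auto
  moreover have "0 \<le> (\<Prod>i=1..n. b i)"
    using b by (intro prod_nonneg) (force intro: order.trans[of 0 1])
  ultimately show ?thesis
    using v by (simp add: powr_divide mult.commute)
qed

section \<open>Exponential bound for truncated partial sums\<close>

lemma negatively_associated_truncated_tail:
  fixes X :: "nat \<Rightarrow> 'a \<Rightarrow> real"
  assumes "prob_space M" and NA: "negatively_associated M I X" and I: "{1..n} \<subseteq> I"
    and int: "\<And>i. i \<in> {1..n} \<Longrightarrow> integrable M (X i)"
      "\<And>i. i \<in> {1..n} \<Longrightarrow> integrable M (\<lambda>\<omega>. (X i \<omega>)\<^sup>2)"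
      "\<And>i. i \<in> {1..n} \<Longrightarrow> integrable M (\<lambda>\<omega>. \<bar>X i \<omega>\<bar> powr p)"
    and mean: "\<And>i. i \<in> {1..n} \<Longrightarrow> (\<integral>\<omega>. X i \<omega> \<partial>M) = 0"
    and \<alpha>: "0 < \<alpha>" "\<alpha> < 1" and pos: "0 < p" "0 < y" "0 < t"
  shows "measure M {\<omega> \<in> space M. \<exists>k\<in>{1..n}. x < (\<Sum>i=1..k. min (X i \<omega>) y)}
    \<le> exp (\<alpha> * (- (t * x) + exp p * t\<^sup>2 / 2 * second_moment_sum M X n
        + exp_remainder_beyond p (t * y) / y powr p * abs_moment_sum M X p n)) / (1 - \<alpha>)"
proof -
  interpret prob_space M by fact
  let ?q = "exp p * t\<^sup>2 / 2" and ?r = "exp_remainder_beyond p (t * y) / y powr p"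
  define \<phi> where "\<phi> s = exp (t * min s y)" for s
  define e where "e i = ?q * (\<integral>\<omega>. (X i \<omega>)\<^sup>2 \<partial>M) + ?r * (\<integral>\<omega>. \<bar>X i \<omega>\<bar> powr p \<partial>M)" for i
  have "mono \<phi>"
    using pos by (auto simp: \<phi>_def intro!: monoI min.mono)
  then have [measurable]: "\<phi> \<in> borel_measurable borel"
    by (rule borel_measurable_mono)
  have X_meas [measurable]: "X i \<in> borel_measurable M" if "i \<in> {1..n}" for i
    using NA I that by (auto simp: negatively_associated_def)
  have \<phi>_meas: "(\<lambda>\<omega>. \<phi> (X i \<omega>)) \<in> borel_measurable M" if "i \<in> {1..n}" for i
    using X_meas[OF that] by measurable
  have \<phi>_pos: "0 < \<phi> s" and \<phi>_le: "\<phi> s \<le> exp (t * y)" for s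
    using pos by (auto simp: \<phi>_def)
  have r: "0 \<le> ?r"
    using exp_remainder_nonneg[of "t * y"] by (auto simp: exp_remainder_beyond_def)
  \<comment> \<open>This makes \<open>exp (e i)\<close> at least 1, as the maximal inequality
    demands of its bounds.\<close>
  have e_nonneg: "0 \<le> e i" for i
    unfolding e_def using r by (intro add_nonneg_nonneg mult_nonneg_nonneg integral_nonneg_AE) auto
  have e: "expectation (\<lambda>\<omega>. \<phi> (X i \<omega>)) \<le> exp (e i)" if i: "i \<in> {1..n}" for i
  proof -
    have "integrable M (\<lambda>\<omega>. \<phi> (X i \<omega>))"
      using \<phi>_pos \<phi>_le \<phi>_meas[OF i]
      by (intro integrable_const_bound[where B = "exp (t * y)"]) (auto simp: less_imp_le)
    then have "expectation (\<lambda>\<omega>. \<phi> (X i \<omega>))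
        \<le> expectation (\<lambda>\<omega>. 1 + t * X i \<omega> + (?q * (X i \<omega>)\<^sup>2 + ?r * \<bar>X i \<omega>\<bar> powr p))"
      using int[OF i] pos
      by (intro integral_mono Bochner_Integration.integrable_add integrable_mult_right integrable_const)
        (auto simp only: \<phi>_def exp_truncated_le)
    \<comment> \<open>The linear term disappears because \<open>X i\<close> has mean zero.\<close>
    also have "\<dots> = 1 + e i"
      using int[OF i] mean[OF i] by (simp add: e_def prob_space del: times_divide_eq_left)
    also have "\<dots> \<le> exp (e i)"
      by (rule exp_ge_add_one_self)
    finally show ?thesis .
  qed
  have prod_\<phi>: "(\<Prod>i=1..k. \<phi> (X i \<omega>)) = exp (t * (\<Sum>i=1..k. min (X i \<omega>) y))" for k \<omega>
    by (simp add: \<phi>_def exp_sum sum_distrib_left)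
  have "{\<omega> \<in> space M. \<exists>k\<in>{1..n}. x < (\<Sum>i=1..k. min (X i \<omega>) y)}
      \<subseteq> {\<omega> \<in> space M. exp (t * x) \<le> running_max (\<lambda>i. \<phi> (X i \<omega>)) n}"
  proof safe
    fix \<omega> k assume "k \<in> {1..n}" "x < (\<Sum>i=1..k. min (X i \<omega>) y)"
    then have "exp (t * x) \<le> (\<Prod>i=1..k. \<phi> (X i \<omega>))"
      using pos unfolding prod_\<phi> by simp
    also have "\<dots> \<le> running_max (\<lambda>i. \<phi> (X i \<omega>)) n"
      using \<open>k \<in> {1..n}\<close> by (intro prod_le_running_max) auto
    finally show "exp (t * x) \<le> running_max (\<lambda>i. \<phi> (X i \<omega>)) n" .
  qed
  moreover have [measurable]: "(\<lambda>\<omega>. running_max (\<lambda>i. \<phi> (X i \<omega>)) n) \<in> borel_measurable M"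
    by (intro measurable_running_max \<phi>_meas)
  have "{\<omega> \<in> space M. exp (t * x) \<le> running_max (\<lambda>i. \<phi> (X i \<omega>)) n} \<in> events"
    by measurable
  ultimately have "measure M {\<omega> \<in> space M. \<exists>k\<in>{1..n}. x < (\<Sum>i=1..k. min (X i \<omega>) y)}
      \<le> measure M {\<omega> \<in> space M. exp (t * x) \<le> running_max (\<lambda>i. \<phi> (X i \<omega>)) n}"
    by (rule finite_measure_mono)
  also have "\<dots> \<le> ((\<Prod>i=1..n. exp (e i)) / exp (t * x)) powr \<alpha> / (1 - \<alpha>)"
    using e e_nonneg \<alpha>
    by (intro negatively_associated_running_max_tail[OF \<open>prob_space M\<close> NA I \<open>mono \<phi>\<close> \<phi>_pos \<phi>_le]) auto
  also have "(\<Prod>i=1..n. exp (e i)) / exp (t * x) = exp (- (t * x) + (\<Sum>i=1..n. e i))"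
    by (simp add: exp_sum exp_diff)
  also have "(\<Sum>i=1..n. e i) = ?q * second_moment_sum M X n + ?r * abs_moment_sum M X p n"
    by (simp add: e_def second_moment_sum_def abs_moment_sum_def sum.distrib sum_distrib_left)
  also have "exp (- (t * x) + (?q * second_moment_sum M X n + ?r * abs_moment_sum M X p n)) powr \<alpha>
      = exp (\<alpha> * (- (t * x) + ?q * second_moment_sum M X n + ?r * abs_moment_sum M X p n))"
    by (simp add: powr_def add.assoc)
  finally show ?thesis .
qed

section \<open>Choice of the exponential parameter\<close>

text \<open>\<open>1 - s \<le> exp (- s)\<close> yields \<open>exp s - 1 \<le> s * exp s\<close>,
  and the hypothesis bounds \<open>exp s\<close> by \<open>1 + r / a\<close>.\<close>

lemma ln_remainder_le:
  fixes a r s :: real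
  assumes "0 < a" "0 < r" "0 \<le> s" "s \<le> ln (1 + r / a)"
  shows "a * (exp s - 1 - s) \<le> r * s"
proof -
  have "exp s \<le> exp (ln (1 + r / a))"
    using assms by simp
  also have "\<dots> = 1 + r / a"
    using assms by (intro exp_ln) (auto intro: add_pos_pos)
  finally have exp_s: "exp s \<le> 1 + r / a" .
  have "1 - s \<le> exp (- s)"
    using exp_ge_add_one_self[of "- s"] by simp
  then have "(1 - s) * exp s \<le> exp (- s) * exp s"
    by (intro mult_right_mono) auto
  then have "exp s - 1 \<le> s * exp s"
    by (simp add: algebra_simps flip: exp_add)
  also have "\<dots> \<le> s * (1 + r / a)"
    using exp_s assms by (intro mult_left_mono) auto
  finally have "a * (exp s - 1) \<le> a * (s * (1 + r / a))"
    using assms by (intro mult_left_mono) auto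
  then show ?thesis
    using assms by (simp add: algebra_simps)
qed

text \<open>The preferred parameter is \<open>t1\<close>. If \<open>t1 * y\<close> exceeds both
  \<open>p\<close> and \<open>L\<close>, the smaller parameter \<open>max L p / y\<close> is used
  and the value drops below \<open>exp (- L)\<close>.\<close>

lemma fuk_nagaev_parameter:
  fixes a D x \<alpha> p :: real
  assumes pos: "0 < a" "0 < D" "0 < x" "0 < \<alpha>" "0 < p"
  defines "y \<equiv> \<alpha> * (p / (p + 2)) * x"
  obtains t where "0 < t"
    "exp (\<alpha> * (- (t * x) + D * t\<^sup>2 / 2 + exp_remainder_beyond p (t * y) * a))
      \<le> exp (- (\<alpha> * (2 / ((p + 2)\<^sup>2 * D) * x\<^sup>2)))
    \<or> exp (\<alpha> * (- (t * x) + D * t\<^sup>2 / 2 + exp_remainder_beyond p (t * y) * a)) \<le> \<alpha> * a"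
proof -
  define \<gamma> where "\<gamma> = 2 / (p + 2)"
  \<comment> \<open>The largest \<open>s\<close> that \<open>ln_remainder_le\<close> permits with
    \<open>r = 1 / \<alpha>\<close>; moreover \<open>exp (- L)\<close> is at most
    \<open>\<alpha> * a\<close>.\<close>
  define L where "L = ln (1 + 1 / \<alpha> / a)"
  \<comment> \<open>The minimizer \<open>x / D\<close> of the quadratic part, shrunk by
    \<open>\<gamma>\<close>. The slack \<open>(1 - \<gamma>) * x\<close>, which is
    \<open>y / \<alpha>\<close>, pays for the \<open>p\<close>-th moment term.\<close>
  define t1 where "t1 = \<gamma> * x / D"
  have \<gamma>: "0 < \<gamma>" "p / (p + 2) = 1 - \<gamma>" "\<gamma> < 1"
    using pos by (auto simp: \<gamma>_def field_simps)
  have "(1 - \<gamma>) * (1 + 1 / p) = p / (p + 2) + 1 / (p + 2)"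
    using pos unfolding \<gamma>(2)[symmetric] by (simp add: distrib_left)
  moreover have "1 - \<gamma> / 2 = p / (p + 2) + 1 / (p + 2)"
    using pos by (simp add: \<gamma>_def field_simps)
  ultimately have \<gamma>_half: "1 - \<gamma> / 2 = (1 - \<gamma>) * (1 + 1 / p)"
    by simp
  have y: "y = \<alpha> * ((1 - \<gamma>) * x)" "0 < y"
    using pos \<gamma> by (auto simp: y_def)
  have L: "0 < L" "exp L = 1 + 1 / \<alpha> / a"
    using pos by (auto simp: L_def add_pos_pos intro!: ln_gt_zero)
  have expL: "exp (- L) \<le> \<alpha> * a"
  proof -
    have "1 \<le> (1 + 1 / \<alpha> / a) * (\<alpha> * a)"
      using pos by (simp add: field_simps)
    then show ?thesis
      using L pos by (simp add: exp_minus field_simps)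
  qed
  have t1: "0 < t1" "D * t1 = \<gamma> * x"
    using pos \<gamma> by (auto simp: t1_def)
  \<comment> \<open>Here \<open>D * t\<close> is at most \<open>\<gamma> * x\<close>, so the
    quadratic term consumes at most the fraction \<open>\<gamma> / 2\<close> of the linear one. The
    surplus \<open>1 / p\<close> in the factor is what case 2 spends.\<close>
  have half: "- (t * x) + D * t\<^sup>2 / 2 \<le> - (t * y / \<alpha> * (1 + 1 / p))" if "0 < t" "t \<le> t1" for t
  proof -
    have "D * t \<le> \<gamma> * x"
      using that pos t1(2) mult_left_mono[of t t1 D] by simp
    then have "D * t * t \<le> \<gamma> * x * t"
      using that by (intro mult_right_mono) auto
    then have "- (t * x) + D * t\<^sup>2 / 2 \<le> - (t * x * (1 - \<gamma> / 2))"
      by (simp add: power2_eq_square algebra_simps)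
    also have "t * x * (1 - \<gamma> / 2) = t * y / \<alpha> * (1 + 1 / p)"
      using pos by (simp add: \<gamma>_half y(1))
    finally show ?thesis .
  qed
  consider "t1 * y \<le> p \<or> t1 * y \<le> L" | "L < t1 * y" "p < t1 * y" "p \<le> L" | "L < p" "p < t1 * y"
    by linarith
  then show thesis
  proof cases
    case 1
    \<comment> \<open>Either \<open>t1 * y \<le> p\<close> and the remainder is 0, or
      \<open>t1 * y \<le> L\<close> and \<open>ln_remainder_le\<close> applies.\<close>
    have "a * exp_remainder_beyond p (t1 * y) \<le> t1 * y / \<alpha>"
    proof (cases "p < t1 * y")
      case True
      then show ?thesis
        using 1 ln_remainder_le[of a "1 / \<alpha>" "t1 * y"] pos t1 y
        by (simp add: exp_remainder_beyond_def L_def)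
    next
      case False
      moreover have "0 \<le> t1 * y / \<alpha>"
        using pos t1 y(2) by simp
      ultimately show ?thesis
        by (simp add: exp_remainder_beyond_def)
    qed
    also have "t1 * y / \<alpha> = t1 * ((1 - \<gamma>) * x)"
      using pos by (simp add: y(1))
    also have "\<dots> = t1 * x - D * t1 * t1"
      using t1(2) by (simp add: algebra_simps)
    finally have le: "- (t1 * x) + D * t1\<^sup>2 / 2 + exp_remainder_beyond p (t1 * y) * a \<le> - (D * t1\<^sup>2 / 2)"
      by (simp add: power2_eq_square mult_ac)
    have gauss: "D * t1\<^sup>2 / 2 = 2 / ((p + 2)\<^sup>2 * D) * x\<^sup>2"
    proof -
      have "D * t1\<^sup>2 / 2 = \<gamma>\<^sup>2 / 2 * (x\<^sup>2 / D)"
        using pos by (simp add: t1_def power2_eq_square mult_ac)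
      moreover have "\<gamma>\<^sup>2 / 2 = 2 / (p + 2)\<^sup>2"
        by (simp add: \<gamma>_def power_divide)
      ultimately show ?thesis
        by simp
    qed
    have "\<alpha> * (- (t1 * x) + D * t1\<^sup>2 / 2 + exp_remainder_beyond p (t1 * y) * a)
        \<le> \<alpha> * - (2 / ((p + 2)\<^sup>2 * D) * x\<^sup>2)"
      using le pos unfolding gauss[symmetric] by (intro mult_left_mono) auto
    then show thesis
      by (intro that[OF t1(1)] disjI1) (simp only: exp_le_cancel_iff mult_minus_right)
  next
    case 2
    \<comment> \<open>The remainder term is then at most \<open>1 / \<alpha>\<close>, and
      \<open>p \<le> L\<close> lets the surplus \<open>L / \<alpha> * (1 / p)\<close> absorb
      it.\<close>
    define t where "t = L / y"
    have t: "0 < t" "t * y = L"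
      using L y(2) by (auto simp: t_def)
    have "t \<le> t1"
      using 2 y(2) by (simp add: t_def divide_le_eq)
    then have "- (t * x) + D * t\<^sup>2 / 2 \<le> - (L / \<alpha> * (1 + 1 / p))"
      using half[OF t(1)] unfolding t(2) by simp
    moreover have "exp_remainder_beyond p (t * y) * a \<le> (exp L - 1 - L) * a"
      using pos exp_remainder_nonneg[of L] unfolding t(2)
      by (intro mult_right_mono) (auto simp: exp_remainder_beyond_def)
    moreover have "(exp L - 1 - L) * a = 1 / \<alpha> - L * a"
      using pos by (simp add: L(2) field_simps)
    moreover have "1 / \<alpha> \<le> L / \<alpha> * (1 / p)"
      using 2 pos by (simp add: field_simps)
    moreover have "0 \<le> L * a"
      using L pos by simp
    ultimately have "- (t * x) + D * t\<^sup>2 / 2 + exp_remainder_beyond p (t * y) * a \<le> - (L / \<alpha>)"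
      unfolding ring_distribs by linarith
    then have "\<alpha> * (- (t * x) + D * t\<^sup>2 / 2 + exp_remainder_beyond p (t * y) * a) \<le> \<alpha> * - (L / \<alpha>)"
      using pos by (intro mult_left_mono) auto
    then have "exp (\<alpha> * (- (t * x) + D * t\<^sup>2 / 2 + exp_remainder_beyond p (t * y) * a)) \<le> \<alpha> * a"
      using expL pos by (intro order.trans[OF _ expL]) simp
    then show thesis
      using t(1) by (intro that[of t]) auto
  next
    case 3
    \<comment> \<open>At \<open>t * y = p\<close> the remainder is still 0, and the quadratic part
      is already below \<open>- (L / \<alpha>)\<close> since \<open>L < p\<close>.\<close>
    define t where "t = p / y"
    have t: "0 < t" "t * y = p"
      using pos y(2) by (auto simp: t_def)
    have "t \<le> t1"
      using 3 y(2) by (simp add: t_def divide_le_eq)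
    then have "- (t * x) + D * t\<^sup>2 / 2 \<le> - (p / \<alpha> * (1 + 1 / p))"
      using half[OF t(1)] unfolding t(2) by simp
    also have "\<dots> = - ((p + 1) / \<alpha>)"
      using pos by (simp add: field_simps)
    also have "\<dots> \<le> - (L / \<alpha>)"
      using 3 pos by (simp add: divide_right_mono)
    finally have "\<alpha> * (- (t * x) + D * t\<^sup>2 / 2) \<le> \<alpha> * - (L / \<alpha>)"
      using pos by (intro mult_left_mono) auto
    then have "exp (\<alpha> * (- (t * x) + D * t\<^sup>2 / 2 + exp_remainder_beyond p (t * y) * a)) \<le> \<alpha> * a"
      using pos unfolding t(2) by (intro order.trans[OF _ expL]) (simp add: exp_remainder_beyond_def)
    then show thesis
      using t(1) by (intro that[of t]) auto
  qed
qed

section \<open>Moments and the Fuk-Nagaev inequality\<close>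

lemma AE_zero_of_moment_zero:
  fixes Y :: "'a \<Rightarrow> real"
  assumes "integrable M (\<lambda>\<omega>. \<bar>Y \<omega>\<bar> powr q)" "(\<integral>\<omega>. \<bar>Y \<omega>\<bar> powr q \<partial>M) = 0"
  shows "AE \<omega> in M. Y \<omega> = 0"
  using assms by (subst (asm) integral_nonneg_eq_0_iff_AE) auto

lemma powr_2_abs: "\<bar>s :: real\<bar> powr 2 = s\<^sup>2"
  by (cases "s = 0") simp_all

lemma (in prob_space) integrable_square_of_powr:
  fixes Y :: "'a \<Rightarrow> real"
  assumes "integrable M (\<lambda>\<omega>. \<bar>Y \<omega>\<bar> powr p)" "2 \<le> p" "Y \<in> borel_measurable M"
  shows "integrable M (\<lambda>\<omega>. (Y \<omega>)\<^sup>2)"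
proof (rule Bochner_Integration.integrable_bound)
  show "integrable M (\<lambda>\<omega>. 1 + \<bar>Y \<omega>\<bar> powr p)"
    using assms by simp
  show "AE \<omega> in M. norm ((Y \<omega>)\<^sup>2) \<le> norm (1 + \<bar>Y \<omega>\<bar> powr p)"
  proof (rule AE_I2)
    fix \<omega>
    have "\<bar>Y \<omega>\<bar> powr 2 \<le> 1 + \<bar>Y \<omega>\<bar> powr p"
    proof (cases "\<bar>Y \<omega>\<bar> \<le> 1")
      case True
      then have "\<bar>Y \<omega>\<bar> powr 2 \<le> 1 powr 2"
        by (intro powr_mono2) auto
      then show ?thesis by (simp add: add_increasing2)
    next
      case False
      then have "\<bar>Y \<omega>\<bar> powr 2 \<le> \<bar>Y \<omega>\<bar> powr p"
        using assms by (intro powr_mono) auto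
      then show ?thesis by simp
    qed
    then show "norm ((Y \<omega>)\<^sup>2) \<le> norm (1 + \<bar>Y \<omega>\<bar> powr p)"
      by (simp add: powr_2_abs)
  qed
qed (use assms in measurable)

lemma (in prob_space) prob_gt_le_powr_moment:
  fixes Y :: "'a \<Rightarrow> real"
  assumes int: "integrable M (\<lambda>\<omega>. \<bar>Y \<omega>\<bar> powr p)" and "0 < p" "0 < y"
    and [measurable]: "Y \<in> borel_measurable M"
  shows "prob {\<omega> \<in> space M. y < Y \<omega>} \<le> expectation (\<lambda>\<omega>. \<bar>Y \<omega>\<bar> powr p) / y powr p"
proof -
  have "prob {\<omega> \<in> space M. y < Y \<omega>} \<le> prob {\<omega> \<in> space M. y powr p \<le> \<bar>Y \<omega>\<bar> powr p}"
    using assms(2,3) by (intro finite_measure_mono) (auto intro: powr_mono2)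
  also have "\<dots> \<le> expectation (\<lambda>\<omega>. \<bar>Y \<omega>\<bar> powr p) / y powr p"
    using assms(3) by (intro integral_Markov_inequality_measure[OF int, of "{}"]) auto
  finally show ?thesis .
qed

lemma negatively_associated_fuk_nagaev:
  fixes M :: "'a measure" and X :: "nat \<Rightarrow> 'a \<Rightarrow> real"
  assumes "prob_space M" and NA: "negatively_associated M I X" and I: "{1..n} \<subseteq> I"
    and int: "\<And>i. i \<in> {1..n} \<Longrightarrow> integrable M (X i)"
      "\<And>i. i \<in> {1..n} \<Longrightarrow> integrable M (\<lambda>\<omega>. \<bar>X i \<omega>\<bar> powr p)"
    and mean: "\<And>i. i \<in> {1..n} \<Longrightarrow> (\<integral>\<omega>. X i \<omega> \<partial>M) = 0"
    and "1 \<le> n" and \<alpha>: "0 < \<alpha>" "\<alpha> < 1" and p: "2 \<le> p" and x: "0 < x"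
  shows "measure M {\<omega> \<in> space M. Max ((\<lambda>k. partial_sum X k \<omega>) ` {1..n}) > x}
    \<le> inverse (1 - \<alpha>) *
       ((1 + 2 / p) powr p * (abs_moment_sum M X p n / (\<alpha> powr p * x powr p))
        + gaussian_term (\<alpha> * (2 / ((p + 2)\<^sup>2 * exp p))) x (second_moment_sum M X n))"
proof -
  interpret prob_space M by fact
  let ?V = "abs_moment_sum M X p n" and ?B = "second_moment_sum M X n"
  let ?E = "{\<omega> \<in> space M. Max ((\<lambda>k. partial_sum X k \<omega>) ` {1..n}) > x}"
  have E_eq: "?E = {\<omega> \<in> space M. \<exists>k\<in>{1..n}. x < partial_sum X k \<omega>}"
    using \<open>1 \<le> n\<close> by (auto simp: Max_gr_iff)
  have X_meas [measurable]: "X i \<in> borel_measurable M" if "i \<in> {1..n}" for i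
    using int(1)[OF that] by auto
  have int2: "integrable M (\<lambda>\<omega>. (X i \<omega>)\<^sup>2)" if "i \<in> {1..n}" for i
    using that int(2) p by (intro integrable_square_of_powr) auto
  have B_nonneg: "0 \<le> ?B" and V_nonneg: "0 \<le> ?V"
    by (auto simp: second_moment_sum_def abs_moment_sum_def intro!: sum_nonneg integral_nonneg_AE)
  have B_0: "AE \<omega> in M. X i \<omega> = 0" if "?B = 0" "i \<in> {1..n}" for i
  proof -
    have "expectation (\<lambda>\<omega>. (X i \<omega>)\<^sup>2) = 0"
      using that unfolding second_moment_sum_def
      by (subst (asm) sum_nonneg_eq_0_iff) (auto intro!: integral_nonneg_AE)
    then show ?thesis
      using int2[OF that(2)] by (intro AE_zero_of_moment_zero[of M _ 2]) (simp_all add: powr_2_abs)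
  qed
  have V_0: "AE \<omega> in M. X i \<omega> = 0" if "?V = 0" "i \<in> {1..n}" for i
  proof -
    have "expectation (\<lambda>\<omega>. \<bar>X i \<omega>\<bar> powr p) = 0"
      using that unfolding abs_moment_sum_def
      by (subst (asm) sum_nonneg_eq_0_iff) (auto intro!: integral_nonneg_AE)
    then show ?thesis
      using int(2)[OF that(2)] by (intro AE_zero_of_moment_zero)
  qed
  show ?thesis
  proof (cases "?B = 0")
    case True
    \<comment> \<open>With vanishing variance sum all variables are 0 almost everywhere, so the
      event is null; this is needed because \<open>gaussian_term\<close> is then 0.\<close>
    have "AE \<omega> in M. \<forall>i\<in>{1..n}. X i \<omega> = 0"
      using B_0[OF True] by (intro AE_finite_allI) auto
    then have "AE \<omega> in M. \<omega> \<notin> ?E"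
    proof eventually_elim
      case (elim \<omega>)
      then have "partial_sum X k \<omega> = 0" if "k \<in> {1..n}" for k
        using that by (auto simp: partial_sum_def intro!: sum.neutral)
      then show ?case
        unfolding E_eq using x by auto
    qed
    moreover have "?E \<in> events"
      unfolding E_eq partial_sum_def by measurable
    ultimately have "prob ?E = 0"
      by (subst prob_eq_0) auto
    then show ?thesis
      using V_nonneg \<alpha> True by (simp add: gaussian_term_def)
  next
    case False
    \<comment> \<open>Positivity of \<open>?V\<close> makes \<open>a\<close> positive, as the choice
      of parameter requires.\<close>
    have "?V \<noteq> 0"
    proof
      assume "?V = 0"
      then have "expectation (\<lambda>\<omega>. (X i \<omega>)\<^sup>2) = 0" if "i \<in> {1..n}" for i
        using V_0[OF _ that] by (intro integral_eq_zero_AE) auto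
      then show False
        using False by (simp add: second_moment_sum_def)
    qed
    then have V: "0 < ?V" and B: "0 < ?B"
      using V_nonneg B_nonneg False by auto
    define y where "y = \<alpha> * (p / (p + 2)) * x"
    define a where "a = ?V / y powr p"
    have y: "0 < y"
      using \<alpha> p x by (simp add: y_def)
    have a: "0 < a"
      using V y by (simp add: a_def)
    \<comment> \<open>The ratio \<open>p / (p + 2)\<close> in the truncation level is the reciprocal
      of \<open>1 + 2 / p\<close>, which produces the constant of the claim.\<close>
    have a_eq: "a = (1 + 2 / p) powr p * (?V / (\<alpha> powr p * x powr p))"
    proof -
      have "1 + 2 / p = (p + 2) / p"
        using p by (simp add: field_simps)
      then have "(1 + 2 / p) powr p = inverse ((p / (p + 2)) powr p)"
        using p by (simp add: powr_divide)
      moreover have "y powr p = \<alpha> powr p * (p / (p + 2)) powr p * x powr p"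
        using \<alpha> p x unfolding y_def by (subst powr_mult | simp)+
      ultimately show ?thesis
        by (simp add: a_def divide_inverse)
    qed
    let ?G = "exp (- (\<alpha> * (2 / ((p + 2)\<^sup>2 * (exp p * ?B)) * x\<^sup>2)))"
    obtain t where t: "0 < t"
      "exp (\<alpha> * (- (t * x) + exp p * ?B * t\<^sup>2 / 2 + exp_remainder_beyond p (t * y) * a)) \<le> ?G
      \<or> exp (\<alpha> * (- (t * x) + exp p * ?B * t\<^sup>2 / 2 + exp_remainder_beyond p (t * y) * a)) \<le> \<alpha> * a"
      using fuk_nagaev_parameter[of a "exp p * ?B" x \<alpha> p] a B x \<alpha> p unfolding y_def by auto
    let ?T = "{\<omega> \<in> space M. \<exists>k\<in>{1..n}. x < (\<Sum>i=1..k. min (X i \<omega>) y)}"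
    \<comment> \<open>If no variable exceeds \<open>y\<close>, truncation leaves every partial sum
      unchanged.\<close>
    have "?E \<subseteq> (\<Union>i\<in>{1..n}. {\<omega> \<in> space M. y < X i \<omega>}) \<union> ?T"
    proof
      fix \<omega> assume "\<omega> \<in> ?E"
      then obtain k where k: "\<omega> \<in> space M" "k \<in> {1..n}" "x < partial_sum X k \<omega>"
        unfolding E_eq by auto
      show "\<omega> \<in> (\<Union>i\<in>{1..n}. {\<omega> \<in> space M. y < X i \<omega>}) \<union> ?T"
      proof (cases "\<exists>i\<in>{1..n}. y < X i \<omega>")
        case False
        then have "partial_sum X k \<omega> = (\<Sum>i=1..k. min (X i \<omega>) y)"
          using k unfolding partial_sum_def by (intro sum.cong) (auto simp: not_less min_def)
        then show ?thesis
          using k by auto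
      qed (use k in auto)
    qed
    moreover have T_meas: "?T \<in> events"
      using X_meas by measurable
    ultimately have "prob ?E \<le> prob ((\<Union>i\<in>{1..n}. {\<omega> \<in> space M. y < X i \<omega>}) \<union> ?T)"
      by (intro finite_measure_mono) auto
    also have "\<dots> \<le> prob (\<Union>i\<in>{1..n}. {\<omega> \<in> space M. y < X i \<omega>}) + prob ?T"
      using T_meas by (intro measure_Un_le) auto
    finally have E_T: "prob ?E \<le> prob (\<Union>i\<in>{1..n}. {\<omega> \<in> space M. y < X i \<omega>}) + prob ?T" .
    have "prob (\<Union>i\<in>{1..n}. {\<omega> \<in> space M. y < X i \<omega>}) \<le> (\<Sum>i\<in>{1..n}. prob {\<omega> \<in> space M. y < X i \<omega>})"
      by (intro finite_measure_subadditive_finite) auto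
    also have "\<dots> \<le> (\<Sum>i\<in>{1..n}. expectation (\<lambda>\<omega>. \<bar>X i \<omega>\<bar> powr p) / y powr p)"
      using int(2) y p by (intro sum_mono prob_gt_le_powr_moment) auto
    also have "\<dots> = a"
      by (simp add: a_def abs_moment_sum_def sum_divide_distrib)
    finally have U_le: "prob (\<Union>i\<in>{1..n}. {\<omega> \<in> space M. y < X i \<omega>}) \<le> a" .
    have "0 < p"
      using p by simp
    have exponent: "- (t * x) + exp p * t\<^sup>2 / 2 * ?B + exp_remainder_beyond p (t * y) / y powr p * ?V
        = - (t * x) + exp p * ?B * t\<^sup>2 / 2 + exp_remainder_beyond p (t * y) * a"
      by (simp add: a_def)
    have "prob ?T \<le> exp (\<alpha> * (- (t * x) + exp p * ?B * t\<^sup>2 / 2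
        + exp_remainder_beyond p (t * y) * a)) / (1 - \<alpha>)"
      using negatively_associated_truncated_tail[OF \<open>prob_space M\<close> NA I int(1) int2 int(2) mean \<alpha>
          \<open>0 < p\<close> y t(1), of x]
      by (simp only: exponent)
    then have E_le: "prob ?E \<le> a + exp (\<alpha> * (- (t * x) + exp p * ?B * t\<^sup>2 / 2
        + exp_remainder_beyond p (t * y) * a)) / (1 - \<alpha>)"
      using E_T U_le by linarith
    have "prob ?E \<le> (a + ?G) / (1 - \<alpha>)"
      using t(2)
    proof
      assume "exp (\<alpha> * (- (t * x) + exp p * ?B * t\<^sup>2 / 2 + exp_remainder_beyond p (t * y) * a)) \<le> ?G"
      then have "prob ?E \<le> a + ?G / (1 - \<alpha>)"
        using \<alpha> by (intro order.trans[OF E_le] add_left_mono divide_right_mono) auto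
      moreover have "a \<le> a / (1 - \<alpha>)"
        using a \<alpha> by (simp add: field_simps)
      ultimately show ?thesis
        unfolding add_divide_distrib by linarith
    next
      assume "exp (\<alpha> * (- (t * x) + exp p * ?B * t\<^sup>2 / 2 + exp_remainder_beyond p (t * y) * a)) \<le> \<alpha> * a"
      then have "prob ?E \<le> a + \<alpha> * a / (1 - \<alpha>)"
        using \<alpha> by (intro order.trans[OF E_le] add_left_mono divide_right_mono) auto
      also have "\<dots> = a / (1 - \<alpha>)"
        using \<alpha> by (simp add: field_simps)
      also have "\<dots> \<le> (a + ?G) / (1 - \<alpha>)"
        using \<alpha> by (intro divide_right_mono) auto
      finally show ?thesis .
    qed
    moreover have "?G = gaussian_term (\<alpha> * (2 / ((p + 2)\<^sup>2 * exp p))) x ?B"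
      using False by (simp add: gaussian_term_def mult_ac)
    ultimately show ?thesis
      unfolding a_eq by (simp add: divide_inverse mult.commute)
  qed
qed

theorem proposition2p3:
  fixes M :: "'a measure" and X :: "nat \<Rightarrow> 'a \<Rightarrow> real" and n :: nat and \<alpha> p :: real
  assumes "prob_space M"
    and "negatively_associated_seq M X"
    and "\<And>i. i \<ge> 1 \<Longrightarrow> integrable M (X i)"
    and "\<And>i. i \<ge> 1 \<Longrightarrow> (\<integral>\<omega>. X i \<omega> \<partial>M) = 0"
    and "n \<ge> 1" and "0 < \<alpha>" and "\<alpha> < 1" and "p \<ge> 2"
    and "\<And>i. i \<in> {1..n} \<Longrightarrow> integrable M (\<lambda>\<omega>. \<bar>X i \<omega>\<bar> powr p)"
  shows "(\<forall>x>0. measure M {\<omega> \<in> space M. Max ((\<lambda>k. partial_sum X k \<omega>) ` {1..n}) > x}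
            \<le> inverse (1 - \<alpha>) *
               ((1 + 2 / p) powr p * (abs_moment_sum M X p n / (\<alpha> powr p * x powr p))
                + gaussian_term (\<alpha> * (2 / ((p + 2)\<^sup>2 * exp p))) x (second_moment_sum M X n)))
       \<and> (\<forall>x>0. measure M {\<omega> \<in> space M. Max ((\<lambda>k. partial_sum X k \<omega>) ` {1..n}) > x}
            \<le> 2 powr (p + 1) * (1 + 2 / p) powr p * (abs_moment_sum M X p n / x powr p)
               + 2 * gaussian_term (1 / ((p + 2)\<^sup>2 * exp p)) x (second_moment_sum M X n))"
proof -
  \<comment> \<open>The definition for sequences starts at length 2; passing to \<open>Suc n\<close>
    covers \<open>n = 1\<close> as well.\<close>
  have NA: "negatively_associated M {1..Suc n} X"
    using assms(2,5) by (auto simp: negatively_associated_seq_def)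
  have bound: "measure M {\<omega> \<in> space M. Max ((\<lambda>k. partial_sum X k \<omega>) ` {1..n}) > x}
      \<le> inverse (1 - \<beta>) *
         ((1 + 2 / p) powr p * (abs_moment_sum M X p n / (\<beta> powr p * x powr p))
          + gaussian_term (\<beta> * (2 / ((p + 2)\<^sup>2 * exp p))) x (second_moment_sum M X n))"
    if "0 < x" "0 < \<beta>" "\<beta> < 1" for x \<beta>
    using that assms by (intro negatively_associated_fuk_nagaev[OF assms(1) NA]) auto
  \<comment> \<open>The case \<open>\<beta> = 1 / 2\<close>: the prefactor is 2,
    \<open>\<beta> powr p\<close> in the denominator gives \<open>2 powr p\<close>, and the 2 in the
    Gaussian constant cancels.\<close>
  have "measure M {\<omega> \<in> space M. Max ((\<lambda>k. partial_sum X k \<omega>) ` {1..n}) > x}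
      \<le> 2 powr (p + 1) * (1 + 2 / p) powr p * (abs_moment_sum M X p n / x powr p)
         + 2 * gaussian_term (1 / ((p + 2)\<^sup>2 * exp p)) x (second_moment_sum M X n)"
    if "0 < x" for x
  proof -
    have "(1 / 2) powr p = 1 / 2 powr p"
      by (simp add: powr_divide)
    then show ?thesis
      using bound[OF that, of "1 / 2"] by (simp add: powr_add mult_ac)
  qed
  then show ?thesis
    using bound assms(6,7) by blast
qed

end
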